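(* Let $n\ge 1$ be an integer. The tile homology group of the $n$-in-line polyomino in the hexagonal lattice is isomorphic to the group $$\mathbb{Z}^{(n-1)(n-2)}\oplus \mathbb{Z}/n\mathbb{Z}.$$
   Context: The cells of the hexagonal lattice are identified with the points of $\mathbb{Z}^2$, where the cell $(p,q)$ is adjacent to the six cells $(p,q)\pm(1,0)$, $(p,q)\pm(0,1)$, $(p,q)\pm(1,-1)$. The placements of the $n$-in-line polyomino ($n$-bone) are all translates by vectors of $\mathbb{Z}^2$ of the three sets $\{(i,0): 0\le i\le n-1\}$, $\{(0,i): 0\le i\le n-1\}$, $\{(n-1-i,i): 0\le i\le n-1\}$. The tile homology group of the $n$-in-line polyomino is the quotient of the free abelian group on the set $\mathbb{Z}^2$ of cells by the subgroup generated by the elements $\sum_{c\in P}c$, where $P$ runs over all placements of the $n$-in-line polyomino. *)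

theory Defs
  imports "HOL-Algebra.Algebra" "HOL-Algebra.Free_Abelian_Groups" "HOL-Library.Product_Plus"
begin

(* Axial coordinates on the hexagonal lattice: (p, q) is adjacent to
   (p, q) \<plusminus> (1, 0), (p, q) \<plusminus> (0, 1) and (p, q) \<plusminus> (1, -1),
   so the three directions of bones below are the three directions of rows of cells. *)
type_synonym cell = "int \<times> int"

definition basic_bones :: "nat \<Rightarrow> cell set set" where
  "basic_bones n =
    {{(int i, 0) | i. i < n},
     {(0, int i) | i. i < n},
     {(int n - 1 - int i, int i) | i. i < n}}"

definition bone_placements :: "nat \<Rightarrow> cell set set" where
  "bone_placements n = {(\<lambda>c. v + c) ` B | v B. B \<in> basic_bones n}"

(* Meaningful only for finite placements, since the sum over an infinite set is 0. *)
definition tile_relations :: "cell set set \<Rightarrow> (cell \<Rightarrow>\<^sub>0 int) set" where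
  "tile_relations \<P> = generate (free_Abelian_group UNIV) {\<Sum>c\<in>P. frag_of c | P. P \<in> \<P>}"

definition tile_homology_group :: "cell set set \<Rightarrow> (cell \<Rightarrow>\<^sub>0 int) set monoid" where
  "tile_homology_group \<P> = free_Abelian_group UNIV Mod tile_relations \<P>"

end

theory Submission
  imports Defs
begin

text \<open>
  Write the cell \<open>(p, q)\<close> as the monomial \<open>x^p y^q\<close>. The tile homology group is then the ring of
  Laurent polynomials in \<open>x, y\<close> modulo \<open>A(x)\<close>, \<open>A(y)\<close> and \<open>S\<close>, where
  \<open>A(z) = \<Sum>i<n. z^i\<close> and \<open>S = \<Sum>i<n. x^(n-1-i) y^i\<close>. In particular \<open>x^n = y^n = 1\<close>.
  Let \<open>C\<close> be the sum of the monomials \<open>x^a y^b\<close> with \<open>a + b \<le> n - 2\<close>, that is, of a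
  triangle of cells. Then
    \<open>(x - 1) C = S - A(y)\<close> and \<open>(y - 1) C = S - A(x)\<close>,
  so in the quotient the class of \<open>C\<close> is fixed by all translations; as the sum of the \<open>n\<close>
  horizontal translates of \<open>C\<close> is a sum of horizontal bones, \<open>n C = 0\<close>.
  For \<open>n = 1\<close> every cell is a bone and all the groups are trivial, so let \<open>n \<ge> 2\<close>.
  Because \<open>C\<close> is monic of degree \<open>n - 2\<close> in \<open>y\<close>, it rewrites row \<open>n - 2\<close> in terms
  of lower rows, and the bones of directions \<open>x\<close> and \<open>y\<close> remove column \<open>n - 1\<close> and row
  \<open>n - 1\<close>. Hence the group is generated by \<open>C\<close> and the \<open>(n - 1) (n - 2)\<close> cells
  \<open>(a, b)\<close> with \<open>a < n - 1\<close>, \<open>b < n - 2\<close> (lemma \<open>generated\<close>).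

  That there are no relations besides \<open>n C = 0\<close> is seen by evaluating functionals, given by
  functions on the cells. For each generating cell there is an integer function all of
  whose bone sums vanish and which is \<open>1\<close> on that cell and \<open>0\<close> on the other generating
  cells (\<open>coord_fun\<close>); it vanishes on \<open>C\<close>, because \<open>C\<close> is torsion. And there is a function
  whose bone sums are divisible by \<open>n\<close> and whose value on \<open>C\<close> is \<open>1\<close> (\<open>torsion_fun\<close>).
  Together these functionals form a surjective homomorphism onto
  \<open>\<int>^((n-1)(n-2)) \<oplus> \<int>/n\<int>\<close> whose kernel is the group of tile relations.
\<close>

section \<open>Sums over a period\<close>

text \<open>The indicator of the multiples of \<open>n\<close>, with values in the integers.\<close>
definition ind :: "nat \<Rightarrow> int \<Rightarrow> int" where
  "ind n x = of_bool (int n dvd x)"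

lemma ind_period: "ind n (x + int n) = ind n x"
  by (simp add: ind_def)

lemma ind_eq_0: "0 < x \<Longrightarrow> x < int n \<Longrightarrow> ind n x = 0"
  by (auto simp: ind_def dest: zdvd_imp_le)

lemma ind_eq_0': "x < 0 \<Longrightarrow> - int n < x \<Longrightarrow> ind n x = 0"
  using ind_eq_0[of "-x" n] by (simp add: ind_def)

lemma ind_0 [simp]: "ind n 0 = 1"
  by (simp add: ind_def)

lemma sum_period_shift:
  fixes h :: "int \<Rightarrow> 'a::ab_group_add"
  assumes "\<And>x. h (x + int n) = h x"
  shows "(\<Sum>i<n. h (s + int i)) = (\<Sum>i<n. h (c + int i))"
proof -
  have step: "(\<Sum>i<n. h (s + 1 + int i)) = (\<Sum>i<n. h (s + int i))" for s
  proof -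
    have "(\<Sum>i<n. h (s + 1 + int i)) - (\<Sum>i<n. h (s + int i))
        = (\<Sum>i<n. h (s + int (Suc i)) - h (s + int i))"
      by (simp add: sum_subtractf add_ac)
    also have "\<dots> = 0"
      by (subst sum_lessThan_telescope) (simp add: assms)
    finally show ?thesis by simp
  qed
  \<comment> \<open>Both windows have the same sum as the one that starts at 0.\<close>
  have "(\<Sum>i<n. h (s + int i)) = (\<Sum>i<n. h (0 + int i))" for s
  proof (induction s rule: int_induct[where k = 0])
    case (step2 i)
    then show ?case using step[of "i - 1"] by simp
  qed (simp_all add: step)
  then show ?thesis by metis
qed

lemma sum_ind_mult:
  assumes "n \<ge> 1" and "\<And>x. h (x + int n) = h x"
  shows "(\<Sum>i<n. ind n (q + int i - c) * h (q + int i)) = h c"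
proof -
  have *: "ind n (x + int n - c) = ind n (x - c)" for x
    using ind_period[of n "x - c"] by (simp add: algebra_simps)
  have "(\<Sum>i<n. ind n (q + int i - c) * h (q + int i))
      = (\<Sum>i<n. ind n (c + int i - c) * h (c + int i))"
    by (rule sum_period_shift) (simp add: assms *)
  also have "\<dots> = (\<Sum>i<n. if i = 0 then h c else 0)"
    by (intro sum.cong) (auto simp: ind_eq_0)
  also have "\<dots> = h c"
    using assms by simp
  finally show ?thesis .
qed

lemma sum_ind: "n \<ge> 1 \<Longrightarrow> (\<Sum>i<n. ind n (q + int i - c)) = 1"
  using sum_ind_mult[of n "\<lambda>_. 1" q c] by simp

lemma sum_lessThan_rev:
  fixes h :: "int \<Rightarrow> 'a::comm_monoid_add"
  shows "(\<Sum>i<n. h (p - int i)) = (\<Sum>i<n. h (p - int n + 1 + int i))"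
  by (rule sum.reindex_bij_witness[where i = "\<lambda>i. n - 1 - i" and j = "\<lambda>i. n - 1 - i"])
     (auto simp: of_nat_diff algebra_simps)

section \<open>The tile relations of the bones\<close>

text \<open>The placements in the three directions are parametrised by an end cell \<open>(p, q)\<close>; the
  antidiagonal ones start at their cell of largest first coordinate.\<close>
lemma bone_placement_cases:
  assumes "P \<in> bone_placements n"
  obtains (row) p q where "P = (\<lambda>i. (p + int i, q)) ` {..<n}"
  | (col) p q where "P = (\<lambda>i. (p, q + int i)) ` {..<n}"
  | (diag) p q where "P = (\<lambda>i. (p - int i, q + int i)) ` {..<n}"
proof -
  obtain v B where B: "P = (\<lambda>c. v + c) ` B" "B \<in> basic_bones n"
    using assms by (auto simp: bone_placements_def)
  obtain p q where v: "v = (p, q)" by fastforce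
  consider "B = (\<lambda>i. (int i, 0)) ` {..<n}" | "B = (\<lambda>i. (0, int i)) ` {..<n}"
    | "B = (\<lambda>i. (int n - 1 - int i, int i)) ` {..<n}"
    using B(2) unfolding basic_bones_def by blast
  then show thesis
  proof cases
    case 1
    show thesis by (rule row[of p q]) (simp add: B(1) 1 v image_image)
  next
    case 2
    show thesis by (rule col[of p q]) (simp add: B(1) 2 v image_image)
  next
    case 3
    show thesis
      by (rule diag[of "p + int n - 1" q]) (simp add: B(1) 3 v image_image algebra_simps)
  qed
qed

lemma bone_placementI:
  "(\<lambda>i. (p + int i, q)) ` {..<n} \<in> bone_placements n" (is ?row)
  "(\<lambda>i. (p, q + int i)) ` {..<n} \<in> bone_placements n" (is ?col)
  "(\<lambda>i. (p - int i, q + int i)) ` {..<n} \<in> bone_placements n" (is ?diag)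
proof -
  have *: "(\<lambda>c. v + c) ` B \<in> bone_placements n" if "B \<in> basic_bones n" for v B
    using that unfolding bone_placements_def by blast
  have 1: "(\<lambda>i. (int i, 0)) ` {..<n} \<in> basic_bones n"
    and 2: "(\<lambda>i. (0, int i)) ` {..<n} \<in> basic_bones n"
    and 3: "(\<lambda>i. (int n - 1 - int i, int i)) ` {..<n} \<in> basic_bones n"
    unfolding basic_bones_def by blast+
  show ?row using *[OF 1, of "(p, q)"] by (simp add: image_image)
  show ?col using *[OF 2, of "(p, q)"] by (simp add: image_image)
  show ?diag using *[OF 3, of "(p - int n + 1, q)"] by (simp add: image_image algebra_simps)
qed

lemma sum_row: "sum g ((\<lambda>i. (p + int i, q)) ` {..<n}) = (\<Sum>i<n. g (p + int i, q))"
  and sum_col: "sum g ((\<lambda>i. (p, q + int i)) ` {..<n}) = (\<Sum>i<n. g (p, q + int i))"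
  and sum_diag: "sum g ((\<lambda>i. (p - int i, q + int i)) ` {..<n}) = (\<Sum>i<n. g (p - int i, q + int i))"
  by (simp_all add: sum.reindex inj_on_def)

lemma subgroup_tile_relations: "subgroup (tile_relations \<P>) (free_Abelian_group UNIV)"
  unfolding tile_relations_def
  by (rule group.generate_is_subgroup) auto

lemma bone_in_tile_relations:
  "(\<Sum>i<n. frag_of (p + int i, q)) \<in> tile_relations (bone_placements n)"
  "(\<Sum>i<n. frag_of (p, q + int i)) \<in> tile_relations (bone_placements n)"
  "(\<Sum>i<n. frag_of (p - int i, q + int i)) \<in> tile_relations (bone_placements n)"
proof -
  have *: "sum frag_of P \<in> tile_relations (bone_placements n)" if "P \<in> bone_placements n" for P
    unfolding tile_relations_def using that by (auto intro!: generate.incl)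
  show "(\<Sum>i<n. frag_of (p + int i, q)) \<in> tile_relations (bone_placements n)"
    using *[OF bone_placementI(1)[where p=p and q=q]] by (simp only: sum_row)
  show "(\<Sum>i<n. frag_of (p, q + int i)) \<in> tile_relations (bone_placements n)"
    using *[OF bone_placementI(2)[where p=p and q=q]] by (simp only: sum_col)
  show "(\<Sum>i<n. frag_of (p - int i, q + int i)) \<in> tile_relations (bone_placements n)"
    using *[OF bone_placementI(3)[where p=p and q=q]] by (simp only: sum_diag)
qed

section \<open>Subgroups of the free abelian group on the cells\<close>

text \<open>The subgroup criterion, in terms of the additive structure of the type of finitely
  supported functions.\<close>
lemma subgroup_frag_iff:
  "subgroup H (free_Abelian_group UNIV) \<longleftrightarrow> 0 \<in> H \<and> (\<forall>x\<in>H. \<forall>y\<in>H. x - y \<in> H)"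
proof
  assume H: "subgroup H (free_Abelian_group UNIV)"
  show "0 \<in> H \<and> (\<forall>x\<in>H. \<forall>y\<in>H. x - y \<in> H)"
  proof (intro conjI ballI)
    show "0 \<in> H" using subgroup.one_closed[OF H] by simp
    fix x y assume "x \<in> H" "y \<in> H"
    then show "x - y \<in> H"
      using subgroup.m_closed[OF H, of x "-y"] subgroup.m_inv_closed[OF H, of y] by simp
  qed
next
  assume H: "0 \<in> H \<and> (\<forall>x\<in>H. \<forall>y\<in>H. x - y \<in> H)"
  then have minus: "- x \<in> H" if "x \<in> H" for x
    using that by (metis diff_0)
  have "x + y \<in> H" if "x \<in> H" "y \<in> H" for x y
    using H that minus by (metis diff_minus_eq_add)
  with H minus show "subgroup H (free_Abelian_group UNIV)"
    by (auto simp: subgroup_def)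
qed

context
  fixes H :: "('a \<Rightarrow>\<^sub>0 int) set"
  assumes H: "subgroup H (free_Abelian_group UNIV)"
begin

lemma frag_sub_0: "0 \<in> H"
  and frag_sub_diff: "x \<in> H \<Longrightarrow> y \<in> H \<Longrightarrow> x - y \<in> H"
  using H by (auto simp: subgroup_frag_iff)

lemma frag_sub_add: "x \<in> H \<Longrightarrow> y \<in> H \<Longrightarrow> x + y \<in> H"
  using subgroup.m_closed[OF H] by simp

lemma frag_sub_sum: "(\<And>i. i \<in> I \<Longrightarrow> g i \<in> H) \<Longrightarrow> sum g I \<in> H"
  by (induction I rule: infinite_finite_induct) (auto intro: frag_sub_0 frag_sub_add)

lemma frag_sub_cmul: "x \<in> H \<Longrightarrow> frag_cmul k x \<in> H"
  by (rule frag_closure_minus_cmul[where P = "\<lambda>x. x \<in> H"]) (auto intro: frag_sub_0 frag_sub_diff)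

lemma frag_sub_cong: "x - y \<in> H \<Longrightarrow> x \<in> H \<longleftrightarrow> y \<in> H"
  by (metis frag_sub_add frag_sub_diff diff_add_cancel diff_diff_eq2 add_diff_cancel_left')

lemma frag_sub_UNIV: "(\<And>c. frag_of c \<in> H) \<Longrightarrow> x \<in> H"
  by (rule frag_induction[where S = UNIV and P = "\<lambda>x. x \<in> H"])
     (auto intro: frag_sub_0 frag_sub_diff)

text \<open>If a sum and all but one of its terms lie in the subgroup, so does the last term.\<close>
lemma frag_sub_remove:
  assumes "finite I" "j \<in> I" "sum g I \<in> H" "\<And>i. i \<in> I \<Longrightarrow> i \<noteq> j \<Longrightarrow> g i \<in> H"
  shows "g j \<in> H"
proof -
  have "g j = sum g I - sum g (I - {j})"
    using assms(1,2) by (simp add: sum.remove)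
  also have "\<dots> \<in> H"
  proof (rule frag_sub_diff[OF assms(3)])
    show "sum g (I - {j}) \<in> H"
      by (rule frag_sub_sum) (simp add: assms(4))
  qed
  finally show ?thesis .
qed

end

section \<open>Generators of the tile homology group\<close>

text \<open>The sum of the cells of the triangle with lowest corner \<open>(p, q)\<close> and \<open>n - 1\<close> cells on
  each side. It is empty for \<open>n = 1\<close>.\<close>
definition bone_triangle :: "nat \<Rightarrow> int \<Rightarrow> int \<Rightarrow> (cell \<Rightarrow>\<^sub>0 int)" where
  "bone_triangle n p q = (\<Sum>b<n - 1. \<Sum>a<n - 1 - b. frag_of (p + int a, q + int b))"

lemma sum_triangle_swap:
  fixes g :: "nat \<Rightarrow> nat \<Rightarrow> 'a::comm_monoid_add"
  shows "(\<Sum>b<m. \<Sum>a<m - b. g a b) = (\<Sum>a<m. \<Sum>b<m - a. g a b)"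
proof -
  have *: "(\<Sum>a<m - b. h a) = (\<Sum>a<m. if a + b < m then h a else 0)" for h :: "nat \<Rightarrow> 'a" and b
    by (rule sum.mono_neutral_cong_left) auto
  have "(\<Sum>b<m. \<Sum>a<m - b. g a b) = (\<Sum>b<m. \<Sum>a<m. if a + b < m then g a b else 0)"
    by (simp only: *)
  also have "\<dots> = (\<Sum>a<m. \<Sum>b<m. if b + a < m then g a b else 0)"
    by (subst sum.swap) (simp add: add.commute)
  also have "\<dots> = (\<Sum>a<m. \<Sum>b<m - a. g a b)"
    by (simp only: *)
  finally show ?thesis .
qed

lemma bone_triangle_altdef:
  "bone_triangle n p q = (\<Sum>a<n - 1. \<Sum>b<n - 1 - a. frag_of (p + int a, q + int b))"
  unfolding bone_triangle_def by (rule sum_triangle_swap)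

lemma sum_lessThan_shift_diff:
  fixes h :: "int \<Rightarrow> 'a::ab_group_add"
  shows "(\<Sum>a<m. h (p + 1 + int a)) - (\<Sum>a<m. h (p + int a)) = h (p + int m) - h p"
proof -
  have "(\<Sum>a<m. h (p + 1 + int a)) - (\<Sum>a<m. h (p + int a))
      = (\<Sum>a<m. h (p + int (Suc a)) - h (p + int a))"
    by (simp add: sum_subtractf add_ac)
  then show ?thesis by (subst (asm) sum_lessThan_telescope) simp
qed

text \<open>The identity \<open>(x - 1) C = S - A(y)\<close>, multiplied by a monomial: shifting a triangle by one
  cell exchanges its left side for the neighbouring antidiagonal. In the two sums on the
  right-hand side the terms for \<open>i = n - 1\<close> cancel.\<close>
lemma triangle_shift_row:
  assumes "n \<ge> 1"
  shows "bone_triangle n (p + 1) q - bone_triangle n p q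
       = (\<Sum>i<n. frag_of (p + int n - 1 - int i, q + int i)) - (\<Sum>i<n. frag_of (p, q + int i))"
proof -
  obtain m where m: "n = Suc m" using assms by (cases n) auto
  have "bone_triangle n (p + 1) q - bone_triangle n p q
      = (\<Sum>b<m. frag_of (p + int (m - b), q + int b) - frag_of (p, q + int b))"
    unfolding bone_triangle_def sum_subtractf[symmetric]
    by (simp add: m sum_subtractf
        sum_lessThan_shift_diff[where h = "\<lambda>x. frag_of (x, y)" for y])
  also have "\<dots> = (\<Sum>i<m. frag_of (p + int m - int i, q + int i) - frag_of (p, q + int i))"
    by (intro sum.cong) (auto simp: of_nat_diff algebra_simps)
  finally show ?thesis by (simp add: m sum_subtractf)
qed

text \<open>Likewise \<open>(y - 1) C = S - A(x)\<close>.\<close>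
lemma triangle_shift_col:
  assumes "n \<ge> 1"
  shows "bone_triangle n p (q + 1) - bone_triangle n p q
       = (\<Sum>i<n. frag_of (p + int n - 1 - int i, q + int i)) - (\<Sum>i<n. frag_of (p + int i, q))"
proof -
  obtain m where m: "n = Suc m" using assms by (cases n) auto
  have "bone_triangle n p (q + 1) - bone_triangle n p q
      = (\<Sum>a<m. frag_of (p + int a, q + int (m - a)) - frag_of (p + int a, q))"
    unfolding bone_triangle_altdef sum_subtractf[symmetric]
    by (simp add: m sum_subtractf
        sum_lessThan_shift_diff[where h = "\<lambda>y. frag_of (x, y)" for x])
  also have "\<dots> = (\<Sum>a<n. frag_of (p + int a, q + int m - int a)) - (\<Sum>a<n. frag_of (p + int a, q))"
    by (simp add: m sum_subtractf of_nat_diff algebra_simps)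
  also have "(\<Sum>a<n. frag_of (p + int a, q + int m - int a))
           = (\<Sum>i<n. frag_of (p + int n - 1 - int i, q + int i))"
    by (rule sum.reindex_bij_witness[where i = "\<lambda>i. n - 1 - i" and j = "\<lambda>i. n - 1 - i"])
       (auto simp: of_nat_diff algebra_simps m)
  finally show ?thesis .
qed

text \<open>Everything below is stated for an arbitrary subgroup \<open>H\<close> that contains the tile
  relations, so that it serves both for the relations themselves and for the subgroup
  generated by them and the proposed generators.\<close>
context
  fixes n :: nat and H :: "(cell \<Rightarrow>\<^sub>0 int) set"
  assumes n: "n \<ge> 1"
    and H: "subgroup H (free_Abelian_group UNIV)"
    and rel: "tile_relations (bone_placements n) \<subseteq> H"
begin

lemma row_in: "(\<Sum>i<n. frag_of (p + int i, q)) \<in> H"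
  and col_in: "(\<Sum>i<n. frag_of (p, q + int i)) \<in> H"
  and diag_in: "(\<Sum>i<n. frag_of (p - int i, q + int i)) \<in> H"
  using bone_in_tile_relations rel by blast+

lemma triangle_step_row: "bone_triangle n (p + 1) q - bone_triangle n p q \<in> H"
  unfolding triangle_shift_row[OF n] by (intro frag_sub_diff[OF H] diag_in col_in)

lemma triangle_step_col: "bone_triangle n p (q + 1) - bone_triangle n p q \<in> H"
  unfolding triangle_shift_col[OF n] by (intro frag_sub_diff[OF H] diag_in row_in)

lemma triangle_row: "bone_triangle n p q - bone_triangle n 0 q \<in> H"
proof (induction p rule: int_induct[where k = 0])
  case (step1 i)
  then show ?case using frag_sub_add[OF H step1(2) triangle_step_row[of i q]] by simp
next
  case (step2 i)
  then show ?case using frag_sub_diff[OF H step2(2) triangle_step_row[of "i - 1" q]] by simp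
qed (simp add: frag_sub_0[OF H])

lemma triangle_col: "bone_triangle n p q - bone_triangle n p 0 \<in> H"
proof (induction q rule: int_induct[where k = 0])
  case (step1 i)
  then show ?case using frag_sub_add[OF H step1(2) triangle_step_col[of p i]] by simp
next
  case (step2 i)
  then show ?case using frag_sub_diff[OF H step2(2) triangle_step_col[of p "i - 1"]] by simp
qed (simp add: frag_sub_0[OF H])

lemma triangle_cong: "bone_triangle n p q - bone_triangle n 0 0 \<in> H"
  using frag_sub_add[OF H triangle_row[of p q] triangle_col[of 0 q]] by simp

lemma period_row: "frag_of (p + int n, q) - frag_of (p, q) \<in> H"
  using frag_sub_diff[OF H row_in[of "p + 1" q] row_in[of p q]]
  unfolding sum_lessThan_shift_diff[where h = "\<lambda>x. frag_of (x, q)"] .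

lemma period_col: "frag_of (p, q + int n) - frag_of (p, q) \<in> H"
  using frag_sub_diff[OF H col_in[of p "q + 1"] col_in[of p q]]
  unfolding sum_lessThan_shift_diff[where h = "\<lambda>y. frag_of (p, y)"] .

text \<open>The \<open>n\<close> triangles obtained by horizontal shifts are congruent to each other, and their
  sum consists of horizontal bones, one starting at each cell of the triangle.\<close>
lemma triangle_torsion: "frag_cmul (int n) (bone_triangle n 0 0) \<in> H"
proof -
  have "(\<Sum>i<n. bone_triangle n (int i) 0)
      = (\<Sum>b<n - 1. \<Sum>a<n - 1 - b. \<Sum>i<n. frag_of (int a + int i, int b))"
    unfolding bone_triangle_def by (subst sum.swap, subst (2) sum.swap) (simp add: add_ac)
  also have "\<dots> \<in> H"
    by (intro frag_sub_sum[OF H] row_in)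
  finally have 1: "(\<Sum>i<n. bone_triangle n (int i) 0) \<in> H" .
  have 2: "(\<Sum>i<n. bone_triangle n (int i) 0 - bone_triangle n 0 0) \<in> H"
    by (intro frag_sub_sum[OF H] triangle_cong)
  have "(\<Sum>i<k. bone_triangle n 0 0) = frag_cmul (int k) (bone_triangle n 0 0)" for k :: nat
    by (induction k) (simp_all add: frag_cmul_distrib algebra_simps)
  with frag_sub_diff[OF H 1 2] show ?thesis by (simp add: sum_subtractf)
qed

lemma frag_of_mod: "frag_of (p, q) - frag_of (p mod int n, q mod int n) \<in> H"
proof -
  have row: "frag_of (p + k * int n, q) - frag_of (p, q) \<in> H" for k p q
  proof (induction k rule: int_induct[where k = 0])
    case (step1 i)
    then show ?case using frag_sub_add[OF H step1(2) period_row[of "p + i * int n" q]]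
      by (simp add: algebra_simps)
  next
    case (step2 i)
    then show ?case using frag_sub_diff[OF H step2(2) period_row[of "p + (i - 1) * int n" q]]
      by (simp add: algebra_simps)
  qed (simp add: frag_sub_0[OF H])
  have col: "frag_of (p, q + k * int n) - frag_of (p, q) \<in> H" for k p q
  proof (induction k rule: int_induct[where k = 0])
    case (step1 i)
    then show ?case using frag_sub_add[OF H step1(2) period_col[of p "q + i * int n"]]
      by (simp add: algebra_simps)
  next
    case (step2 i)
    then show ?case using frag_sub_diff[OF H step2(2) period_col[of p "q + (i - 1) * int n"]]
      by (simp add: algebra_simps)
  qed (simp add: frag_sub_0[OF H])
  show ?thesis
    using frag_sub_add[OF H row[of "p mod int n" "p div int n" q]
        col[of "p mod int n" "q mod int n" "q div int n"]]
    by simp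
qed

text \<open>The cells with \<open>a < n - 1\<close>, \<open>b < n - 2\<close> and the triangle generate the group: row bones
  and periodicity yield the rows below \<open>n - 2\<close>, the triangle yields row \<open>n - 2\<close>, and column
  bones yield row \<open>n - 1\<close>.\<close>
lemma generated:
  assumes cells: "\<And>a b. a < n - 1 \<Longrightarrow> b < n - 2 \<Longrightarrow> frag_of (int a, int b) \<in> H"
    and tri: "bone_triangle n 0 0 \<in> H"
  shows "x \<in> H"
proof -
  have low: "frag_of (p, int b) \<in> H" if b: "b < n - 2" for p b
  proof -
    have "frag_of (int a, int b) \<in> H" if "a < n" for a
    proof (cases "a = n - 1")
      case True
      have "frag_of (0 + int (n - 1), int b) \<in> H"
        by (rule frag_sub_remove[OF H, where I = "{..<n}"])
           (use n b cells row_in[of 0 "int b"] in auto)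
      then show ?thesis using True by simp
    qed (use that b cells in auto)
    from this[of "nat (p mod int n)"] have "frag_of (p mod int n, int b) \<in> H"
      using n by (simp add: nat_less_iff)
    moreover have "int b mod int n = int b" using b by simp
    ultimately show ?thesis
      using frag_sub_cong[OF H frag_of_mod[of p "int b"]] by simp
  qed
  have mid: "frag_of (p, int (n - 2)) \<in> H" if "n \<ge> 2" for p
  proof -
    \<comment> \<open>The top row of a triangle is a single cell; all its other cells lie in lower rows.\<close>
    have "(\<Sum>a<n - 1 - (n - 2). frag_of (p + int a, 0 + int (n - 2))) \<in> H"
    proof (rule frag_sub_remove[OF H, where I = "{..<n - 1}" and j = "n - 2"
          and g = "\<lambda>b. \<Sum>a<n - 1 - b. frag_of (p + int a, 0 + int b)"])
      show "(\<Sum>b<n - 1. \<Sum>a<n - 1 - b. frag_of (p + int a, 0 + int b)) \<in> H"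
        using tri frag_sub_cong[OF H triangle_cong[of p 0]] by (simp add: bone_triangle_def)
    next
      fix b assume "b \<in> {..<n - 1}" "b \<noteq> n - 2"
      then have "b < n - 2" by simp
      then show "(\<Sum>a<n - 1 - b. frag_of (p + int a, 0 + int b)) \<in> H"
        by (intro frag_sub_sum[OF H]) (simp add: low)
    qed (use that in auto)
    moreover have "n - 1 - (n - 2) = 1" using that by simp
    ultimately show ?thesis by simp
  qed
  have most: "frag_of (p, int b) \<in> H" if "b < n - 1" for p b
  proof (cases "b = n - 2")
    case True
    with that show ?thesis using mid[of p] by simp
  next
    case False
    with that show ?thesis by (intro low) simp
  qed
  have all: "frag_of (p, int b) \<in> H" if "b < n" for p b
  proof (cases "b = n - 1")
    case True
    have "frag_of (p, 0 + int (n - 1)) \<in> H"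
      by (rule frag_sub_remove[OF H, where I = "{..<n}"])
         (use n most col_in[of p 0] in auto)
    then show ?thesis using True by simp
  next
    case False
    with that show ?thesis by (intro most) simp
  qed
  have "frag_of (p, q) \<in> H" for p q
  proof -
    have "frag_of (p mod int n, q mod int n) \<in> H"
      using all[of "nat (q mod int n)" "p mod int n"] n by (simp add: nat_less_iff)
    then show ?thesis using frag_sub_cong[OF H frag_of_mod[of p q]] by simp
  qed
  then have "frag_of c \<in> H" for c by (cases c) simp
  then show ?thesis by (rule frag_sub_UNIV[OF H])
qed

end

section \<open>Functionals on the free abelian group\<close>

text \<open>The homomorphism to the integers that extends a function on the free generators.\<close>
definition frag_eval :: "('a \<Rightarrow> int) \<Rightarrow> ('a \<Rightarrow>\<^sub>0 int) \<Rightarrow> int" where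
  "frag_eval F x = (\<Sum>c\<in>Poly_Mapping.keys x. Poly_Mapping.lookup x c * F c)"

lemma frag_eval_superset:
  assumes "finite S" "Poly_Mapping.keys x \<subseteq> S"
  shows "frag_eval F x = (\<Sum>c\<in>S. Poly_Mapping.lookup x c * F c)"
  unfolding frag_eval_def
  by (rule sum.mono_neutral_left) (use assms in \<open>auto simp: in_keys_iff\<close>)

lemma frag_eval_0 [simp]: "frag_eval F 0 = 0"
  by (simp add: frag_eval_def)

lemma frag_eval_of [simp]: "frag_eval F (frag_of c) = F c"
  by (simp add: frag_eval_def)

lemma frag_eval_diff [simp]: "frag_eval F (x - y) = frag_eval F x - frag_eval F y"
proof -
  let ?S = "Poly_Mapping.keys x \<union> Poly_Mapping.keys y"
  have "Poly_Mapping.keys (x - y) \<subseteq> ?S" by (rule keys_diff)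
  then show ?thesis
    by (simp add: frag_eval_superset[of ?S] lookup_minus left_diff_distrib sum_subtractf)
qed

lemma frag_eval_add [simp]: "frag_eval F (x + y) = frag_eval F x + frag_eval F y"
  using frag_eval_diff[of F "x + y" y] by simp

lemma frag_eval_sum [simp]: "frag_eval F (sum g I) = (\<Sum>i\<in>I. frag_eval F (g i))"
  by (induction I rule: infinite_finite_induct) auto

lemma frag_eval_cmul [simp]: "frag_eval F (frag_cmul k x) = k * frag_eval F x"
  by (simp add: frag_eval_superset[of "Poly_Mapping.keys x"] keys_cmul sum_distrib_left mult.assoc)

text \<open>A functional is divisible by \<open>m\<close> on the tile relations if it is so on the bones. The case
  \<open>m = 0\<close> says that it vanishes.\<close>
lemma frag_eval_tile_relations:
  assumes "x \<in> tile_relations (bone_placements n)"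
    and "\<And>p q. m dvd (\<Sum>i<n. F (p + int i, q))"
    and "\<And>p q. m dvd (\<Sum>i<n. F (p, q + int i))"
    and "\<And>p q. m dvd (\<Sum>i<n. F (p - int i, q + int i))"
  shows "m dvd frag_eval F x"
proof -
  have "subgroup {x. m dvd frag_eval F x} (free_Abelian_group UNIV)"
    by (auto simp: subgroup_frag_iff)
  moreover have "{sum frag_of P |P. P \<in> bone_placements n} \<subseteq> {x. m dvd frag_eval F x}"
    using assms(2-) by (auto elim!: bone_placement_cases simp: sum_row sum_col sum_diag)
  ultimately have "tile_relations (bone_placements n) \<subseteq> {x. m dvd frag_eval F x}"
    unfolding tile_relations_def by (intro group.generate_subgroup_incl) auto
  then show ?thesis using assms(1) by auto
qed

section \<open>The torsion functional\<close>

text \<open>The function that is \<open>1\<close> on the columns \<open>p \<equiv> 0\<close>, \<open>-1\<close> on the columns \<open>p \<equiv> 1\<close> modulo \<open>n\<close>,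
  and \<open>0\<close> elsewhere. A bone in the column direction has sum \<open>n\<close> times a value; the other
  bones meet every residue class once. For \<open>n = 1\<close> it is zero.\<close>
definition torsion_fun :: "nat \<Rightarrow> cell \<Rightarrow> int" where
  "torsion_fun n = (\<lambda>(p, q). ind n p - ind n (p - 1))"

lemma torsion_fun_relations:
  assumes "n \<ge> 1" "x \<in> tile_relations (bone_placements n)"
  shows "int n dvd frag_eval (torsion_fun n) x"
proof (rule frag_eval_tile_relations[OF assms(2)])
  have *: "(\<Sum>i<n. ind n (p + int i) - ind n (p + int i - 1)) = 0" for p
    using sum_ind[OF assms(1), of p 0] sum_ind[OF assms(1), of p 1] by (simp add: sum_subtractf)
  show "int n dvd (\<Sum>i<n. torsion_fun n (p + int i, q))" for p q
    by (simp add: torsion_fun_def *)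
  show "int n dvd (\<Sum>i<n. torsion_fun n (p, q + int i))" for p q
    by (simp add: torsion_fun_def)
  show "int n dvd (\<Sum>i<n. torsion_fun n (p - int i, q + int i))" for p q
    using sum_lessThan_rev[of "\<lambda>p. ind n p - ind n (p - 1)" p n] *[of "p - int n + 1"]
    by (simp only: torsion_fun_def prod.case dvd_0_right)
qed

text \<open>The triangle has \<open>n - 1\<close> cells in column 0 and \<open>n - 2\<close> in column 1.\<close>
lemma torsion_fun_triangle:
  assumes "n \<ge> 2"
  shows "frag_eval (torsion_fun n) (bone_triangle n 0 0) = 1"
proof -
  have inner: "(\<Sum>a<m. ind n (int a) - ind n (int a - 1)) = of_bool (m = 1)"
    if "1 \<le> m" "m < n" for m
    using that
  proof (induction m rule: nat_induct_at_least)
    case base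
    then show ?case using assms by (simp add: ind_eq_0')
  next
    case (Suc m)
    then show ?case by (cases "m = 1") (simp_all add: ind_eq_0)
  qed
  have "frag_eval (torsion_fun n) (bone_triangle n 0 0)
      = (\<Sum>b<n - 1. \<Sum>a<n - 1 - b. ind n (int a) - ind n (int a - 1))"
    by (simp add: bone_triangle_def torsion_fun_def)
  also have "\<dots> = (\<Sum>b<n - 1. if b = n - 2 then 1 else 0)"
  proof (rule sum.cong[OF refl])
    fix b assume "b \<in> {..<n - 1}"
    then show "(\<Sum>a<n - 1 - b. ind n (int a) - ind n (int a - 1)) = (if b = n - 2 then 1 else 0)"
      by (subst inner) auto
  qed
  also have "\<dots> = 1" using assms by simp
  finally show ?thesis .
qed

section \<open>The coordinate functionals\<close>

text \<open>
  The function \<open>coord_fun n a b\<close> is \<open>n\<close>-periodic in both coordinates and supported on the rows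
  \<open>b\<close>, \<open>n - 2\<close> and \<open>n - 1\<close> modulo \<open>n\<close>. Its restriction to row \<open>b\<close> is \<open>low_part\<close>, the
  indicator of column \<open>a\<close> corrected in column \<open>n - 1\<close> so that row sums vanish. Its restriction \<open>mid_part\<close> to row
  \<open>n - 2\<close> is the one that makes the sum over each triangle based in row 0 vanish, and the restriction
  to row \<open>n - 1\<close> makes the column sums vanish. As \<open>ind n\<close> is \<open>n\<close>-periodic,
  the last two rows are selected by \<open>q + 2\<close> and \<open>q + 1\<close>.
\<close>
definition low_part :: "nat \<Rightarrow> nat \<Rightarrow> int \<Rightarrow> int" where
  "low_part n a p = ind n (p - int a) - ind n (p + 1)"

definition mid_part :: "nat \<Rightarrow> nat \<Rightarrow> nat \<Rightarrow> int \<Rightarrow> int" where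
  "mid_part n a b p = - (\<Sum>j<n - 1 - b. low_part n a (p + int j))"

definition coord_fun :: "nat \<Rightarrow> nat \<Rightarrow> nat \<Rightarrow> cell \<Rightarrow> int" where
  "coord_fun n a b = (\<lambda>(p, q). ind n (q - int b) * low_part n a p + ind n (q + 2) * mid_part n a b p
      + ind n (q + 1) * (- low_part n a p - mid_part n a b p))"

lemma low_part_period: "low_part n a (p + int n) = low_part n a p"
  using ind_period[of n "p - int a"] ind_period[of n "p + 1"]
  by (simp add: low_part_def algebra_simps)

lemma mid_part_period: "mid_part n a b (p + int n) = mid_part n a b p"
  using low_part_period[of n a "p + int j" for j] by (simp add: mid_part_def add_ac)

lemma sum_low_part: "n \<ge> 1 \<Longrightarrow> (\<Sum>i<n. low_part n a (p + int i)) = 0"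
  using sum_ind[of n p "int a"] sum_ind[of n p "- 1"]
  by (simp add: low_part_def sum_subtractf)

lemma sum_mid_part: "n \<ge> 1 \<Longrightarrow> (\<Sum>i<n. mid_part n a b (p + int i)) = 0"
  using sum_low_part[of n a "p + int j" for j]
  by (simp add: mid_part_def sum_negf add_ac) (subst sum.swap, simp add: add_ac)

text \<open>This telescoping is what makes the antidiagonal sums of \<open>coord_fun\<close> vanish.\<close>
lemma mid_part_step:
  assumes "b < n"
  shows "mid_part n a b (p + 1) - mid_part n a b p = low_part n a p - low_part n a (p - 1 - int b)"
proof -
  have "p + int (n - 1 - b) = (p - 1 - int b) + int n" using assms by (simp add: of_nat_diff)
  then have "low_part n a (p + int (n - 1 - b)) = low_part n a (p - 1 - int b)"
    by (simp only: low_part_period)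
  then show ?thesis
    using sum_lessThan_shift_diff[of "low_part n a" p "n - 1 - b"]
    unfolding mid_part_def by linarith
qed

lemma coord_fun_relations:
  assumes b: "b < n" and x: "x \<in> tile_relations (bone_placements n)"
  shows "frag_eval (coord_fun n a b) x = 0"
proof -
  have n: "n \<ge> 1" using b by simp
  have "0 dvd frag_eval (coord_fun n a b) x"
  proof (rule frag_eval_tile_relations[OF x])
    fix p q :: int
    show "0 dvd (\<Sum>i<n. coord_fun n a b (p + int i, q))"
      using sum_low_part[OF n] sum_mid_part[OF n]
      by (simp add: coord_fun_def sum.distrib sum_subtractf sum_negf sum_distrib_left[symmetric])
    show "0 dvd (\<Sum>i<n. coord_fun n a b (p, q + int i))"
      using sum_ind[OF n, of q "int b"] sum_ind[OF n, of q "- 2"] sum_ind[OF n, of q "- 1"]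
      by (simp add: coord_fun_def sum.distrib sum_distrib_right[symmetric])
    \<comment> \<open>On an antidiagonal, the first coordinate is \<open>s - j\<close> where \<open>j\<close> is the second one.\<close>
    define s where "s = p + q"
    define low mid where "low j = low_part n a (s - j)" and "mid j = mid_part n a b (s - j)" for j
    have per: "low (j + int n) = low j" "mid (j + int n) = mid j" for j
      using low_part_period[of n a "s - j - int n"] mid_part_period[of n a b "s - j - int n"]
      by (simp_all add: low_def mid_def algebra_simps)
    have "(\<Sum>i<n. coord_fun n a b (p - int i, q + int i))
        = (\<Sum>i<n. ind n (q + int i - int b) * low (q + int i)
              + ind n (q + int i - (- 2)) * mid (q + int i)
              + ind n (q + int i - (- 1)) * (- low (q + int i) - mid (q + int i)))"
      by (simp add: coord_fun_def low_def mid_def s_def algebra_simps)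
    also have "\<dots> = low (int b) + mid (- 2) + (- low (- 1) - mid (- 1))"
      unfolding sum.distrib
      by (subst sum_ind_mult[OF n], simp add: per)+ simp
    also have "\<dots> = 0"
      using mid_part_step[OF b, of a "s + 1"] by (simp add: low_def mid_def add.commute)
    finally show "0 dvd (\<Sum>i<n. coord_fun n a b (p - int i, q + int i))" by simp
  qed
  then show ?thesis by simp
qed

lemma coord_fun_cell:
  assumes "a < n - 1" "b < n - 2" "a' < n - 1" "b' < n - 2"
  shows "coord_fun n a b (int a', int b') = of_bool (a = a' \<and> b = b')"
proof -
  have *: "ind n (int k - int l) = of_bool (k = l)" if "k < n" "l < n" for k l
    using that ind_eq_0[of "int k - int l" n] ind_eq_0'[of "int k - int l" n]
    by (cases k l rule: linorder_cases) auto
  have "ind n (int b' + 2) = 0" "ind n (int b' + 1) = 0" "ind n (int a' + 1) = 0"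
    using assms by (auto intro!: ind_eq_0)
  then show ?thesis
    using assms by (simp add: coord_fun_def low_part_def *) blast
qed

text \<open>An integer-valued functional that kills the relations kills the torsion element.\<close>
lemma coord_fun_triangle:
  assumes "b < n"
  shows "frag_eval (coord_fun n a b) (bone_triangle n 0 0) = 0"
proof -
  have "frag_cmul (int n) (bone_triangle n 0 0) \<in> tile_relations (bone_placements n)"
    using assms by (intro triangle_torsion subgroup_tile_relations) auto
  from coord_fun_relations[OF assms this] show ?thesis using assms by simp
qed

section \<open>The isomorphism\<close>

text \<open>All functionals together. The index \<open>i < (n - 1) (n - 2)\<close> stands for the cell
  \<open>(i div (n - 2), i mod (n - 2))\<close>.\<close>
definition homology_map :: "nat \<Rightarrow> (cell \<Rightarrow>\<^sub>0 int) \<Rightarrow> (nat \<Rightarrow> int) \<times> int" where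
  "homology_map n x =
     (\<lambda>i\<in>{..<(n - 1) * (n - 2)}. frag_eval (coord_fun n (i div (n - 2)) (i mod (n - 2))) x,
      frag_eval (torsion_fun n) x mod int n)"

text \<open>The combination of the generators with coefficients \<open>c\<close> on the cells and \<open>k\<close> on the
  triangle.\<close>
definition normal_form :: "nat \<Rightarrow> (nat \<Rightarrow> int) \<Rightarrow> int \<Rightarrow> (cell \<Rightarrow>\<^sub>0 int)" where
  "normal_form n c k =
     (\<Sum>i<(n - 1) * (n - 2). frag_cmul (c i) (frag_of (int (i div (n - 2)), int (i mod (n - 2)))))
     + frag_cmul k (bone_triangle n 0 0)"

lemma index_bounds:
  assumes "i < (n - 1) * (n - 2)"
  shows "i div (n - 2) < n - 1" "i mod (n - 2) < (n::nat) - 2"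
  using assms by (auto simp: less_mult_imp_div_less intro!: mod_less_divisor gr0I)

lemma normal_form_diff:
  "normal_form n c k - normal_form n d l = normal_form n (\<lambda>i. c i - d i) (k - l)"
  by (simp add: normal_form_def frag_cmul_diff_distrib sum_subtractf)

lemma normal_form_exists:
  assumes n: "n \<ge> 1"
  shows "\<exists>c k. x - normal_form n c k \<in> tile_relations (bone_placements n)"
proof -
  define R where "R = tile_relations (bone_placements n)"
  define H where "H = {x. \<exists>c k. x - normal_form n c k \<in> R}"
  have R: "subgroup R (free_Abelian_group UNIV)"
    unfolding R_def by (rule subgroup_tile_relations)
  have zero: "normal_form n (\<lambda>_. 0) 0 = 0"
    by (simp add: normal_form_def)
  have RH: "R \<subseteq> H"
    unfolding H_def using zero by (metis (mono_tags, lifting) diff_zero mem_Collect_eq subsetI)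
  have "x - y \<in> H" if xy: "x \<in> H" "y \<in> H" for x y
  proof -
    obtain c k d l where "x - normal_form n c k \<in> R" "y - normal_form n d l \<in> R"
      using xy unfolding H_def by blast
    from frag_sub_diff[OF R this]
    have "(x - y) - normal_form n (\<lambda>i. c i - d i) (k - l) \<in> R"
      by (simp add: normal_form_diff[symmetric] algebra_simps)
    then show ?thesis unfolding H_def by blast
  qed
  then have H: "subgroup H (free_Abelian_group UNIV)"
    using RH frag_sub_0[OF R] by (auto simp: subgroup_frag_iff)
  have nfH: "normal_form n c k \<in> H" for c k
    unfolding H_def using frag_sub_0[OF R] by (metis (mono_tags, lifting) diff_self mem_Collect_eq)
  have "x \<in> H"
  proof (rule generated[OF n H RH[unfolded R_def]])
    fix a b assume ab: "a < n - 1" "b < n - 2"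
    have "a * (n - 2) + b < Suc a * (n - 2)" using ab by simp
    also have "\<dots> \<le> (n - 1) * (n - 2)" using ab by (intro mult_right_mono) auto
    finally have lt: "a * (n - 2) + b < (n - 1) * (n - 2)" .
    have "normal_form n (\<lambda>i. if i = a * (n - 2) + b then 1 else 0) 0
        = (\<Sum>i<(n - 1) * (n - 2). if i = a * (n - 2) + b then frag_of (int a, int b) else 0)"
      unfolding normal_form_def frag_cmul_zero add_0_right using ab by (intro sum.cong) simp_all
    also have "\<dots> = frag_of (int a, int b)" using lt by simp
    finally show "frag_of (int a, int b) \<in> H" using nfH by metis
  next
    have "normal_form n (\<lambda>_. 0) 1 = bone_triangle n 0 0" by (simp add: normal_form_def)
    then show "bone_triangle n 0 0 \<in> H" using nfH by metis
  qed
  then show ?thesis unfolding H_def R_def by blast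
qed

lemma coord_fun_normal_form:
  assumes "i < (n - 1) * (n - 2)"
  shows "frag_eval (coord_fun n (i div (n - 2)) (i mod (n - 2))) (normal_form n c k) = c i"
proof -
  have "frag_eval (coord_fun n (i div (n - 2)) (i mod (n - 2))) (bone_triangle n 0 0) = 0"
    using index_bounds[OF assms] by (intro coord_fun_triangle) simp
  then have "frag_eval (coord_fun n (i div (n - 2)) (i mod (n - 2))) (normal_form n c k)
      = (\<Sum>j<(n - 1) * (n - 2). c j * coord_fun n (i div (n - 2)) (i mod (n - 2))
                                      (int (j div (n - 2)), int (j mod (n - 2))))"
    by (simp add: normal_form_def)
  also have "\<dots> = (\<Sum>j<(n - 1) * (n - 2). if j = i then c i else 0)"
  proof (rule sum.cong[OF refl])
    fix j assume "j \<in> {..<(n - 1) * (n - 2)}"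
    then show "c j * coord_fun n (i div (n - 2)) (i mod (n - 2)) (int (j div (n - 2)), int (j mod (n - 2)))
        = (if j = i then c i else 0)"
      using index_bounds[OF assms] index_bounds[of j n]
      by (auto simp: coord_fun_cell) (metis div_mult_mod_eq)
  qed
  also have "\<dots> = c i" using assms by simp
  finally show ?thesis .
qed

text \<open>For \<open>n = 1\<close> the triangle is empty, and the statement holds only because it is a
  congruence modulo 1.\<close>
lemma torsion_fun_normal_form:
  assumes "n \<ge> 1"
  shows "int n dvd frag_eval (torsion_fun n) (normal_form n c k)
                   - frag_eval (torsion_fun n) (normal_form n c 0) - k"
proof (cases "n = 1")
  case False
  then show ?thesis using assms torsion_fun_triangle[of n] by (simp add: normal_form_def)
qed simp

lemma homology_map_kernel:
  assumes n: "n \<ge> 1"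
  shows "homology_map n x = (\<lambda>i\<in>{..<(n - 1) * (n - 2)}. 0, 0)
         \<longleftrightarrow> x \<in> tile_relations (bone_placements n)"
proof
  assume x: "x \<in> tile_relations (bone_placements n)"
  have "frag_eval (coord_fun n (i div (n - 2)) (i mod (n - 2))) x = 0" if "i < (n - 1) * (n - 2)" for i
    using index_bounds[OF that] x by (intro coord_fun_relations) auto
  then show "homology_map n x = (\<lambda>i\<in>{..<(n - 1) * (n - 2)}. 0, 0)"
    using torsion_fun_relations[OF n x] by (auto simp: homology_map_def intro!: restrict_ext)
next
  let ?R = "tile_relations (bone_placements n)"
  note R = subgroup_tile_relations[of "bone_placements n"]
  assume 0: "homology_map n x = (\<lambda>i\<in>{..<(n - 1) * (n - 2)}. 0, 0)"
  obtain c k where ck: "x - normal_form n c k \<in> ?R"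
    using normal_form_exists[OF n] by blast
  have c: "c i = 0" if i: "i < (n - 1) * (n - 2)" for i
  proof -
    let ?F = "coord_fun n (i div (n - 2)) (i mod (n - 2))"
    have "frag_eval ?F x = 0"
      using fun_cong[of _ _ i, OF 0[unfolded homology_map_def, THEN arg_cong[where f = fst], simplified]] i
      by simp
    moreover have "frag_eval ?F (x - normal_form n c k) = 0"
      using index_bounds[OF i] ck by (intro coord_fun_relations) auto
    ultimately show ?thesis
      using coord_fun_normal_form[OF i, of c k] by simp
  qed
  then have nf: "normal_form n c l = frag_cmul l (bone_triangle n 0 0)" for l
    by (simp add: normal_form_def)
  have "int n dvd frag_eval (torsion_fun n) x"
    using 0 by (auto simp: homology_map_def)
  with torsion_fun_relations[OF n ck]
  have "int n dvd frag_eval (torsion_fun n) (normal_form n c k)"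
    by (metis frag_eval_diff dvd_diff_commute dvd_diff diff_diff_eq2 add_diff_cancel_left')
  with torsion_fun_normal_form[OF n, of c k] have "int n dvd k"
    by (simp add: nf) (metis dvd_diff diff_diff_eq2 add_diff_cancel_left')
  then obtain m where "k = int n * m" by (rule dvdE)
  then have "normal_form n c k = frag_cmul m (frag_cmul (int n) (bone_triangle n 0 0))"
    by (simp add: nf mult.commute)
  also have "\<dots> \<in> ?R"
    by (intro frag_sub_cmul[OF R] triangle_torsion[OF n R order_refl])
  finally show "x \<in> ?R" using frag_sub_cong[OF R ck] by simp
qed

lemma homology_map_surj:
  assumes n: "n \<ge> 1"
    and h: "h \<in> {..<(n - 1) * (n - 2)} \<rightarrow>\<^sub>E UNIV" and z: "z \<in> {0..<int n}"
  shows "\<exists>x. homology_map n x = (h, z)"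
proof
  \<comment> \<open>The cells contribute to the torsion coordinate; the multiple of the triangle corrects this.\<close>
  define k where "k = z - frag_eval (torsion_fun n) (normal_form n h 0)"
  have "int n dvd frag_eval (torsion_fun n) (normal_form n h k) - z"
    using torsion_fun_normal_form[OF n, of h k] by (simp add: k_def)
  then have "frag_eval (torsion_fun n) (normal_form n h k) mod int n = z"
    using z by (simp add: mod_eq_dvd_iff[symmetric])
  moreover have "(\<lambda>i\<in>{..<(n - 1) * (n - 2)}.
      frag_eval (coord_fun n (i div (n - 2)) (i mod (n - 2))) (normal_form n h k)) = h"
    using h by (auto simp: coord_fun_normal_form PiE_def extensional_def)
  ultimately show "homology_map n (normal_form n h k) = (h, z)"
    by (simp add: homology_map_def)
qed

theorem proposition15:
  fixes n :: nat
  assumes "n \<ge> 1"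
  shows "tile_homology_group (bone_placements n) \<cong>
    (product_group {..<(n - 1) * (n - 2)} (\<lambda>_. integer_group) \<times>\<times> integer_mod_group n)"
proof -
  let ?A = "free_Abelian_group UNIV :: (cell \<Rightarrow>\<^sub>0 int) monoid"
  let ?B = "product_group {..<(n - 1) * (n - 2)} (\<lambda>_. integer_group) \<times>\<times> integer_mod_group n"
  have carrier: "carrier ?B = ({..<(n - 1) * (n - 2)} \<rightarrow>\<^sub>E UNIV) \<times> {0..<int n}"
    using assms by (simp add: carrier_integer_mod_group)
  have into: "homology_map n x \<in> carrier ?B" for x
    unfolding carrier using assms by (simp add: homology_map_def)
  have "homology_map n \<in> hom ?A ?B"
    using into by (auto simp: hom_def homology_map_def mod_add_eq intro!: restrict_ext)
  then interpret group_hom ?A ?B "homology_map n"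
    by (intro group_hom.intro group_hom_axioms.intro DirProd_group) auto
  have "homology_map n ` carrier ?A = carrier ?B"
  proof
    show "homology_map n ` carrier ?A \<subseteq> carrier ?B" using into by blast
    show "carrier ?B \<subseteq> homology_map n ` carrier ?A"
    proof
      fix y assume "y \<in> carrier ?B"
      then obtain h z where "y = (h, z)" "h \<in> {..<(n - 1) * (n - 2)} \<rightarrow>\<^sub>E UNIV" "z \<in> {0..<int n}"
        unfolding carrier by blast
      then obtain x where "homology_map n x = y" using homology_map_surj[OF assms] by blast
      then show "y \<in> homology_map n ` carrier ?A" by force
    qed
  qed
  moreover have "kernel ?A ?B (homology_map n) = tile_relations (bone_placements n)"
    using homology_map_kernel[OF assms] by (simp add: kernel_def)
  ultimately show ?thesis
    using FactGroup_iso by (simp add: tile_homology_group_def)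
qed

end
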